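(* (i) For $r=2$ there are constants $0<c_2<C_2$ such that, for every integer $n\ge 2$, $$\frac{c_2}{n}\le \Delta_{\mathcal{C}}(n)\le C_2\,\frac{\ln n}{n}.$$ (ii) For any integer $r\ge 3$ there are constants $0<c_r<C_r$ such that, for every integer $n\ge 1$, $$\frac{c_r}{n}\le \Delta_{\mathcal{C}}(n)\le \frac{C_r}{n}.$$
   Context: For fixed $r\ge2$, $\mathcal{C}$ is the set of $r$-tuples $\mathbf{x}=(x_1,\dots,x_r)$ of positive integers with $\gcd(x_1,\dots,x_r)=1$. For $n\ge1$ and $\boldsymbol{\alpha}=(\alpha_1,\dots,\alpha_r)\in[0,1]^r$ put $|\boldsymbol{\alpha}|=\alpha_1\cdots\alpha_r$ and $F(n,\boldsymbol{\alpha})=\#\{\mathbf{x}\in\mathcal{C}: x_j\le n\alpha_j \text{ for } j=1,\dots,r\}$. With $\boldsymbol{1}=(1,\dots,1)$, the discrepancy function of $\mathcal{C}$ is $$\Delta_{\mathcal{C}}(n)=\sup_{\boldsymbol{\alpha}\in[0,1]^r}\bigg|\frac{F(n,\boldsymbol{\alpha})}{F(n,\boldsymbol{1})}-|\boldsymbol{\alpha}|\bigg|.$$ *)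

theory Defs
  imports "HOL-Analysis.Analysis"
begin

text \<open>
  An \<open>r\<close>-tuple is an extensional function on the index set \<open>{1..r}\<close>, so that distinct
  functions are distinct tuples and \<open>r\<close> can be quantified over inside a formula.
\<close>

definition coprime_tuples :: "nat \<Rightarrow> (nat \<Rightarrow> nat) set" where
  "coprime_tuples r = {x \<in> {1..r} \<rightarrow>\<^sub>E {0<..}. Gcd (x ` {1..r}) = 1}"

definition unit_cube :: "nat \<Rightarrow> (nat \<Rightarrow> real) set" where
  "unit_cube r = {1..r} \<rightarrow>\<^sub>E {0..1}"

definition F_count :: "nat \<Rightarrow> nat \<Rightarrow> (nat \<Rightarrow> real) \<Rightarrow> nat" where
  "F_count r n \<alpha> = card {x \<in> coprime_tuples r. \<forall>j\<in>{1..r}. real (x j) \<le> real n * \<alpha> j}"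

text \<open>
  For \<open>r \<ge> 2\<close> and \<open>n \<ge> 1\<close> the set counted by \<open>F_count r n \<alpha>\<close> is finite, and
  \<open>F_count r n (\<lambda>j\<in>{1..r}. 1)\<close> is positive because the all-ones tuple is counted. The quotient
  below thus lies between 0 and 1, so the supremum is over a nonempty bounded set of reals.
\<close>

definition discrepancy :: "nat \<Rightarrow> nat \<Rightarrow> real" where
  "discrepancy r n =
     (SUP \<alpha>\<in>unit_cube r.
        \<bar>real (F_count r n \<alpha>) / real (F_count r n (\<lambda>j\<in>{1..r}. 1)) - (\<Prod>j\<in>{1..r}. \<alpha> j)\<bar>)"

end

theory Submission
  imports Defs
begin

text \<open>
  Sieving by the primes up to \<open>n\<close>, \<open>F(n, \<alpha>)\<close> is the sum over sets \<open>S\<close> of such primes of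
  \<open>(-1)\<^bsup>|S|\<^esup> \<Prod>\<^sub>j \<lfloor>n \<alpha>\<^sub>j / d\<rfloor>\<close> with \<open>d = \<Prod>S\<close>. Only \<open>d \<le> n\<close> matters, and dropping the
  floors costs at most \<open>r (n/d)\<^bsup>r-1\<^esup>\<close> per term. Hence \<open>F(n, \<alpha>) = |\<alpha>| K + O(n\<^bsup>r-1\<^esup> \<Sum>\<^sub>d d\<^bsup>1-r\<^esup>)\<close> with
  \<open>K\<close> independent of \<open>\<alpha>\<close>. Comparing with \<open>\<alpha> = 1\<close> eliminates \<open>K\<close>, so its value
  (about \<open>n\<^bsup>r\<^esup> / \<zeta>(r)\<close>) is never needed, and \<open>F(n, 1) \<ge> n\<^bsup>r\<^esup> / 4\<close> follows from
  \<open>\<Sum>\<^sub>d\<^sub>\<ge>\<^sub>2 1/d\<^sup>2 \<le> 3/4\<close>. For the lower bound, \<open>F\<close> vanishes at \<open>\<alpha> = (1/(2n), 1, \<dots>, 1)\<close>.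
\<close>

section \<open>Squarefree numbers as products of sets of primes\<close>

text \<open>Distinct primes are coprime, so the divisibilities by single members of \<open>S\<close>
  combine one prime at a time.\<close>

lemma prod_primes_dvd_iff:
  fixes m :: nat
  assumes "finite S" "\<And>p. p \<in> S \<Longrightarrow> prime p"
  shows "\<Prod>S dvd m \<longleftrightarrow> (\<forall>p\<in>S. p dvd m)"
  using assms
proof (induction S)
  case (insert q S)
  have "coprime q (\<Prod>S)"
    using insert by (intro prod_coprime_right) (metis insertCI primes_coprime)
  then have "q * \<Prod>S dvd m \<longleftrightarrow> q dvd m \<and> \<Prod>S dvd m"
    by (metis divides_mult dvd_mult_left dvd_mult_right)
  then show ?case
    using insert by simp
qed simp

text \<open>Unique factorisation: \<open>S\<close> is recovered as the set of prime divisors of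
  \<open>\<Prod>S\<close>. This later allows a sum over sets of primes to be reindexed by the
  integers \<open>d\<close>, each occurring at most once.\<close>

lemma inj_on_prod_primes:
  fixes P :: "nat set"
  assumes "finite P" "\<And>p. p \<in> P \<Longrightarrow> prime p"
  shows "inj_on \<Prod> (Pow P)"
proof -
  have eq: "S = {p. prime p \<and> p dvd \<Prod>S}" if "S \<in> Pow P" for S
  proof -
    have S: "finite S" "\<And>p. p \<in> S \<Longrightarrow> prime p"
      using that assms finite_subset by auto
    show ?thesis
    proof (intro equalityI subsetI)
      fix p assume "p \<in> {p. prime p \<and> p dvd \<Prod>S}"
      then obtain q where "q \<in> S" "p dvd q" "prime p"
        using S(1) by (auto simp: prime_dvd_prod_iff)
      then show "p \<in> S"
        using S(2)[of q] primes_dvd_imp_eq by metis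
    qed (use S in auto)
  qed
  show ?thesis
  proof (rule inj_onI)
    fix S T assume ST: "S \<in> Pow P" "T \<in> Pow P" "\<Prod>S = \<Prod>T"
    show "S = T"
      by (subst eq[OF ST(1)], subst eq[OF ST(2)]) (simp only: ST(3))
  qed
qed

text \<open>Expanding the product of \<open>1 - of_bool (p dvd g)\<close> over \<open>P\<close>
  gives the left side. Since \<open>(-1) ^ card S\<close> is the Moebius function at
  \<open>\<Prod>S\<close>, this is Moebius inversion restricted to the primes in
  \<open>P\<close>.\<close>

lemma sum_alternating_prod_dvd:
  fixes g :: nat
  assumes "finite P" "\<And>p. p \<in> P \<Longrightarrow> prime p"
  shows "(\<Sum>S\<in>Pow P. (-1) ^ card S * of_bool (\<Prod>S dvd g)) = (of_bool (\<forall>p\<in>P. \<not> p dvd g) :: real)"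
proof -
  have prod_of_bool: "(\<Prod>p\<in>S. of_bool (Q p)) = (of_bool (\<forall>p\<in>S. Q p) :: real)"
    if "finite S" for S and Q :: "nat \<Rightarrow> bool"
    using that by induction auto
  have "of_bool (\<forall>p\<in>P. \<not> p dvd g) = (\<Prod>p\<in>P. of_bool (\<not> p dvd g) :: real)"
    using assms prod_of_bool by simp
  also have "\<dots> = (\<Prod>p\<in>P. 1 - of_bool (p dvd g))"
    by (intro prod.cong) auto
  also have "\<dots> = (\<Sum>S\<in>Pow P. (-1) ^ card S * (\<Prod>p\<in>S. of_bool (p dvd g)))"
    using prod_diff_conv_sum[OF assms(1), of "\<lambda>_. 1" "\<lambda>p. of_bool (p dvd g)"] by simp
  also have "\<dots> = (\<Sum>S\<in>Pow P. (-1) ^ card S * of_bool (\<Prod>S dvd g))"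
  proof (intro sum.cong refl)
    fix S assume "S \<in> Pow P"
    then have "finite S" "\<And>p. p \<in> S \<Longrightarrow> prime p"
      using assms finite_subset by auto
    then show "(-1) ^ card S * (\<Prod>p\<in>S. of_bool (p dvd g)) =
        ((-1) ^ card S * of_bool (\<Prod>S dvd g) :: real)"
      by (simp add: prod_of_bool prod_primes_dvd_iff)
  qed
  finally show ?thesis ..
qed

section \<open>Lattice points in boxes\<close>

text \<open>The modulus \<open>d\<close> is a parameter so that one definition serves both the sides
  of a box (\<open>d = 1\<close>) and the sides of its sublattice of points divisible by
  \<open>d\<close>.\<close>

definition multiples_upto :: "real \<Rightarrow> nat \<Rightarrow> nat set" where
  "multiples_upto y d = {k. 0 < k \<and> real k \<le> y \<and> d dvd k}"

definition lattice_box :: "nat \<Rightarrow> nat \<Rightarrow> (nat \<Rightarrow> real) \<Rightarrow> (nat \<Rightarrow> nat) set" where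
  "lattice_box r n \<alpha> = (\<Pi>\<^sub>E j\<in>{1..r}. multiples_upto (real n * \<alpha> j) 1)"

lemma finite_multiples_upto [simp]: "finite (multiples_upto y d)"
proof (rule finite_subset)
  show "multiples_upto y d \<subseteq> {..nat \<lfloor>y\<rfloor>}"
    by (auto simp: multiples_upto_def le_nat_floor)
qed simp

lemma finite_lattice_box [simp]: "finite (lattice_box r n \<alpha>)"
  unfolding lattice_box_def by (intro finite_PiE) auto

lemma card_multiples_upto:
  assumes "0 < d" "0 \<le> y"
  shows "card (multiples_upto y d) = nat \<lfloor>y / real d\<rfloor>"
proof -
  have "multiples_upto y d = (\<lambda>k. d * k) ` {1..nat \<lfloor>y / real d\<rfloor>}"
  proof (intro equalityI subsetI)
    fix x assume "x \<in> multiples_upto y d"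
    then obtain k where "x = d * k" "0 < k" "real d * real k \<le> y"
      by (auto simp: multiples_upto_def)
    then show "x \<in> (\<lambda>k. d * k) ` {1..nat \<lfloor>y / real d\<rfloor>}"
      using assms by (intro image_eqI[of _ _ k]) (auto intro!: le_nat_floor simp: field_simps)
  next
    fix x assume "x \<in> (\<lambda>k. d * k) ` {1..nat \<lfloor>y / real d\<rfloor>}"
    then obtain k where k: "x = d * k" "1 \<le> k" "k \<le> nat \<lfloor>y / real d\<rfloor>"
      using assms by auto
    then have "real k \<le> y / real d"
      using assms by (simp add: le_nat_iff le_floor_iff)
    then show "x \<in> multiples_upto y d"
      using k assms by (auto simp: multiples_upto_def field_simps)
  qed
  moreover have "inj_on (\<lambda>k. d * k) {1..nat \<lfloor>y / real d\<rfloor>}"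
    using assms by (simp add: inj_on_def)
  ultimately show ?thesis
    by (simp add: card_image)
qed

lemma card_multiples_upto_le:
  assumes "0 < d" "0 \<le> y"
  shows "real (card (multiples_upto y d)) \<le> y / real d"
  using assms by (simp add: card_multiples_upto)

lemma card_multiples_upto_ge:
  assumes "0 < d" "0 \<le> y"
  shows "y / real d - 1 \<le> real (card (multiples_upto y d))"
proof -
  have "real_of_int \<lfloor>y / real d\<rfloor> = real (nat \<lfloor>y / real d\<rfloor>)"
    using assms by simp
  then show ?thesis
    using assms by (simp add: card_multiples_upto)
qed

text \<open>Divisibility by \<open>d\<close> is a condition on each coordinate separately, so the
  points in question again form a product set.\<close>

lemma card_lattice_box_dvd:
  "card {x \<in> lattice_box r n \<alpha>. \<forall>j\<in>{1..r}. d dvd x j} =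
    (\<Prod>j\<in>{1..r}. card (multiples_upto (real n * \<alpha> j) d))"
proof -
  have "{x \<in> lattice_box r n \<alpha>. \<forall>j\<in>{1..r}. d dvd x j} =
      (\<Pi>\<^sub>E j\<in>{1..r}. multiples_upto (real n * \<alpha> j) d)"
    by (auto simp: lattice_box_def multiples_upto_def PiE_iff extensional_def)
  then show ?thesis
    by (simp add: card_PiE)
qed

lemma F_count_eq: "F_count r n \<alpha> = card {x \<in> lattice_box r n \<alpha>. Gcd (x ` {1..r}) = 1}"
  unfolding F_count_def
  by (rule arg_cong[where f = card])
    (auto simp: coprime_tuples_def lattice_box_def multiples_upto_def PiE_iff)

lemma unit_cubeD:
  assumes "\<alpha> \<in> unit_cube r" "j \<in> {1..r}"
  shows "0 \<le> \<alpha> j" "\<alpha> j \<le> 1"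
  using assms by (auto simp: unit_cube_def PiE_iff)

lemma unit_cube_prod:
  assumes "\<alpha> \<in> unit_cube r"
  shows "0 \<le> (\<Prod>j\<in>{1..r}. \<alpha> j)" "(\<Prod>j\<in>{1..r}. \<alpha> j) \<le> 1"
  using unit_cubeD[OF assms] by (auto intro!: prod_nonneg prod_le_1)

lemma one_in_unit_cube: "(\<lambda>j\<in>{1..r}. 1) \<in> unit_cube r"
  by (auto simp: unit_cube_def)

lemma lattice_box_bounds:
  assumes "x \<in> lattice_box r n \<alpha>" "\<alpha> \<in> unit_cube r" "j \<in> {1..r}"
  shows "0 < x j" "x j \<le> n"
proof -
  have x: "0 < x j" "real (x j) \<le> real n * \<alpha> j"
    using assms by (auto simp: lattice_box_def multiples_upto_def PiE_iff)
  moreover have "real n * \<alpha> j \<le> real n"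
    using unit_cubeD[OF assms(2,3)] by (simp add: mult_left_le)
  ultimately show "0 < x j" "x j \<le> n"
    using x by auto
qed

text \<open>The gcd divides the first coordinate, which exists because \<open>1 \<le> r\<close> and
  lies between 1 and \<open>n\<close>. Hence every prime dividing the gcd is at most
  \<open>n\<close>, and finitely many primes suffice to detect coprimality.\<close>

lemma Gcd_lattice_box_bounds:
  assumes "x \<in> lattice_box r n \<alpha>" "\<alpha> \<in> unit_cube r" "1 \<le> r"
  shows "0 < Gcd (x ` {1..r})" "Gcd (x ` {1..r}) \<le> n"
proof -
  have x: "0 < x 1" "x 1 \<le> n"
    using lattice_box_bounds[OF assms(1,2), of 1] assms(3) by auto
  have "Gcd (x ` {1..r}) dvd x 1"
    using assms(3) by (intro Gcd_dvd) auto
  then show "0 < Gcd (x ` {1..r})" "Gcd (x ` {1..r}) \<le> n"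
    using x by (auto dest: dvd_imp_le intro: Nat.gr0I)
qed

section \<open>The sieve\<close>

text \<open>The indicator of gcd 1 is replaced by the alternating sum over sets of primes up to
  \<open>n\<close>, and the two sums are swapped. As \<open>\<Prod>S\<close> divides the gcd exactly
  when it divides every coordinate, the inner sum counts a sublattice of the box.\<close>

lemma F_count_sieve:
  assumes "\<alpha> \<in> unit_cube r" "1 \<le> r"
  shows "real (F_count r n \<alpha>) = (\<Sum>S\<in>Pow {p. prime p \<and> p \<le> n}. (-1) ^ card S *
    (\<Prod>j\<in>{1..r}. real (card (multiples_upto (real n * \<alpha> j) (\<Prod>S)))))"
proof -
  define P where "P = {p :: nat. prime p \<and> p \<le> n}"
  have P: "finite P" "\<And>p. p \<in> P \<Longrightarrow> prime p"
    by (auto simp: P_def)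
  define g where "g x = Gcd (x ` {1..r})" for x :: "nat \<Rightarrow> nat"
  have coprime_iff: "g x = 1 \<longleftrightarrow> (\<forall>p\<in>P. \<not> p dvd g x)" if "x \<in> lattice_box r n \<alpha>" for x
  proof
    assume "g x = 1"
    then show "\<forall>p\<in>P. \<not> p dvd g x"
      using P not_prime_unit by metis
  next
    assume *: "\<forall>p\<in>P. \<not> p dvd g x"
    show "g x = 1"
    proof (rule ccontr)
      assume "g x \<noteq> 1"
      then obtain p where p: "prime p" "p dvd g x"
        using prime_factor_nat by blast
      then have "p \<le> n"
        using Gcd_lattice_box_bounds[OF that assms] unfolding g_def
        by (meson dvd_imp_le le_trans)
      with p * show False
        by (auto simp: P_def)
    qed
  qed
  have "real (F_count r n \<alpha>) = (\<Sum>x\<in>lattice_box r n \<alpha>. of_bool (g x = 1))"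
    by (simp add: F_count_eq g_def sum.If_cases of_bool_def Int_def flip: card_eq_sum)
  also have "\<dots> = (\<Sum>x\<in>lattice_box r n \<alpha>. \<Sum>S\<in>Pow P. (-1) ^ card S * of_bool (\<Prod>S dvd g x))"
    using P coprime_iff
    by (intro sum.cong refl, subst sum_alternating_prod_dvd) simp_all
  also have "\<dots> = (\<Sum>S\<in>Pow P. (-1) ^ card S * (\<Sum>x\<in>lattice_box r n \<alpha>. of_bool (\<Prod>S dvd g x)))"
    by (subst sum.swap) (simp only: sum_distrib_left)
  also have "\<dots> = (\<Sum>S\<in>Pow P. (-1) ^ card S *
    (\<Prod>j\<in>{1..r}. real (card (multiples_upto (real n * \<alpha> j) (\<Prod>S)))))"
  proof (intro sum.cong refl arg_cong2[where f = "(*)"])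
    fix S
    have "(\<Sum>x\<in>lattice_box r n \<alpha>. of_bool (\<Prod>S dvd g x)) =
        real (card {x \<in> lattice_box r n \<alpha>. \<forall>j\<in>{1..r}. \<Prod>S dvd x j})"
      by (simp add: g_def dvd_Gcd_iff sum.If_cases of_bool_def Int_def)
    then show "(\<Sum>x\<in>lattice_box r n \<alpha>. of_bool (\<Prod>S dvd g x)) =
        (\<Prod>j\<in>{1..r}. real (card (multiples_upto (real n * \<alpha> j) (\<Prod>S))))"
      by (simp only: card_lattice_box_dvd of_nat_prod)
  qed
  finally show ?thesis
    by (simp add: P_def)
qed

text \<open>Dividing by \<open>M\<close> moves all factors into [0,1], where the difference of two
  products is at most the sum of the differences of their factors. Each of these is at most
  \<open>1 / M\<close>, and multiplying back by \<open>M ^ card I\<close> leaves one power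
  fewer.\<close>

lemma abs_prod_diff_le:
  fixes a y :: "'i \<Rightarrow> real"
  assumes "finite I" "I \<noteq> {}" "0 < M"
    and "\<And>i. i \<in> I \<Longrightarrow> 0 \<le> a i" "\<And>i. i \<in> I \<Longrightarrow> a i \<le> y i"
    and "\<And>i. i \<in> I \<Longrightarrow> y i \<le> a i + 1" "\<And>i. i \<in> I \<Longrightarrow> y i \<le> M"
  shows "\<bar>(\<Prod>i\<in>I. a i) - (\<Prod>i\<in>I. y i)\<bar> \<le> real (card I) * M ^ (card I - 1)"
proof -
  have scale: "(\<Prod>i\<in>I. f i / M) = (\<Prod>i\<in>I. f i) / M ^ card I" for f
    by (simp add: prod_dividef)
  have "norm ((\<Prod>i\<in>I. a i / M) - (\<Prod>i\<in>I. y i / M)) \<le> (\<Sum>i\<in>I. norm (a i / M - y i / M))"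
  proof (rule norm_prod_diff)
    fix i assume "i \<in> I"
    then show "norm (a i / M) \<le> 1" "norm (y i / M) \<le> 1"
      using assms(3) assms(4-7)[of i] by (auto simp: abs_le_iff)
  qed
  also have "\<dots> \<le> (\<Sum>i\<in>I. 1 / M)"
  proof (rule sum_mono)
    fix i assume "i \<in> I"
    then have "\<bar>a i - y i\<bar> \<le> 1"
      using assms(5,6)[of i] by simp
    then have "\<bar>a i - y i\<bar> / M \<le> 1 / M"
      using assms(3) by (intro divide_right_mono) auto
    then show "norm (a i / M - y i / M) \<le> 1 / M"
      using assms(3) by (simp flip: diff_divide_distrib)
  qed
  finally have "\<bar>(\<Prod>i\<in>I. a i) - (\<Prod>i\<in>I. y i)\<bar> / M ^ card I \<le> real (card I) / M"
    using assms(3) by (simp add: scale flip: diff_divide_distrib)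
  then have "\<bar>(\<Prod>i\<in>I. a i) - (\<Prod>i\<in>I. y i)\<bar> \<le> real (card I) / M * M ^ card I"
    using assms(3) by (simp add: pos_divide_le_eq)
  also have "\<dots> = real (card I) * M ^ (card I - 1)"
    using assms(1-3) by (cases "card I") auto
  finally show ?thesis .
qed

text \<open>The form with \<open>obtains\<close> records that a single \<open>K\<close> serves all
  \<alpha>, which is what allows \<alpha> to be compared with the all-ones vector.\<close>

lemma F_count_approx:
  assumes "1 \<le> n" "1 \<le> r"
  obtains K where "\<And>\<alpha>. \<alpha> \<in> unit_cube r \<Longrightarrow>
    \<bar>real (F_count r n \<alpha>) - (\<Prod>j\<in>{1..r}. \<alpha> j) * K\<bar>
      \<le> real r * real n ^ (r - 1) * (\<Sum>d=1..n. 1 / real d ^ (r - 1))"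
proof
  define P where "P = {p :: nat. prime p \<and> p \<le> n}"
  define Q where "Q = {S \<in> Pow P. \<Prod>S \<le> n}"
  \<comment> \<open>This is the sum of \<open>mu(d) (n/d)^r\<close> over squarefree
    \<open>d \<le> n\<close>, with \<open>mu\<close> the Moebius function and \<open>d\<close>
    encoded as its set of prime factors.\<close>
  define K where "K = (\<Sum>S\<in>Q. (-1) ^ card S * (real n / real (\<Prod>S)) ^ r)"
  have P: "finite P" "\<And>p. p \<in> P \<Longrightarrow> prime p"
    by (auto simp: P_def)
  have prod_pos: "0 < \<Prod>S" if "S \<in> Pow P" for S
    using that P by (intro prod_pos) (auto dest: prime_gt_0_nat)
  have Q: "finite Q" "Q \<subseteq> Pow P"
    using P by (auto simp: Q_def)
  fix \<alpha> assume \<alpha>: "\<alpha> \<in> unit_cube r"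
  define a where "a S j = real (card (multiples_upto (real n * \<alpha> j) (\<Prod>S)))" for S j
  define y where "y S j = real n * \<alpha> j / real (\<Prod>S)" for S j
  have y_le: "y S j \<le> real n / real (\<Prod>S)" if "j \<in> {1..r}" for S j
    unfolding y_def using unit_cubeD[OF \<alpha> that]
    by (intro divide_right_mono) (auto simp: mult_left_le simp del: of_nat_prod)
  have a_le: "a S j \<le> y S j" and a_ge: "y S j \<le> a S j + 1"
    if "S \<in> Pow P" "j \<in> {1..r}" for S j
    unfolding a_def y_def
    using card_multiples_upto_le[OF prod_pos[OF that(1)], of "real n * \<alpha> j"]
      card_multiples_upto_ge[OF prod_pos[OF that(1)], of "real n * \<alpha> j"]
      unit_cubeD[OF \<alpha> that(2)] by auto
  have "real (F_count r n \<alpha>) = (\<Sum>S\<in>Pow P. (-1) ^ card S * (\<Prod>j\<in>{1..r}. a S j))"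
    using F_count_sieve[OF \<alpha> assms(2)] by (simp add: P_def a_def)
  also have "\<dots> = (\<Sum>S\<in>Q. (-1) ^ card S * (\<Prod>j\<in>{1..r}. a S j))"
  proof (rule sum.mono_neutral_right)
    \<comment> \<open>If \<open>\<Prod>S\<close> exceeds \<open>n\<close>, then \<open>a S 1\<close>
      is a count below 1, hence 0, and it annihilates the product. These sets must go before the
      floors are dropped, since each would otherwise add to the error.\<close>
    show "\<forall>S\<in>Pow P - Q. (-1) ^ card S * (\<Prod>j\<in>{1..r}. a S j) = 0"
    proof
      fix S assume S: "S \<in> Pow P - Q"
      have j: "1 \<in> {1..r}"
        using assms by simp
      have "n < \<Prod>S"
        using S by (simp add: Q_def not_le)
      then have "real n / real (\<Prod>S) < 1"
        by (simp del: of_nat_prod)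
      then have "a S 1 < 1"
        using a_le[of S 1] y_le[OF j, of S] S j by simp
      then have "a S 1 = 0"
        by (simp add: a_def)
      then show "(-1) ^ card S * (\<Prod>j\<in>{1..r}. a S j) = 0"
        using j by auto
    qed
  qed (use P Q in auto)
  finally have F: "real (F_count r n \<alpha>) = (\<Sum>S\<in>Q. (-1) ^ card S * (\<Prod>j\<in>{1..r}. a S j))" .
  have prod_y: "(\<Prod>j\<in>{1..r}. y S j) = (\<Prod>j\<in>{1..r}. \<alpha> j) * (real n / real (\<Prod>S)) ^ r" for S
    by (simp add: y_def prod_dividef prod.distrib power_divide)
  have "(\<Prod>j\<in>{1..r}. \<alpha> j) * K = (\<Sum>S\<in>Q. (-1) ^ card S * (\<Prod>j\<in>{1..r}. y S j))"
    unfolding K_def prod_y sum_distrib_left by (intro sum.cong refl) (simp only: mult_ac)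
  with F have "\<bar>real (F_count r n \<alpha>) - (\<Prod>j\<in>{1..r}. \<alpha> j) * K\<bar>
      = \<bar>\<Sum>S\<in>Q. (-1) ^ card S * ((\<Prod>j\<in>{1..r}. a S j) - (\<Prod>j\<in>{1..r}. y S j))\<bar>"
    by (simp only: right_diff_distrib sum_subtractf)
  also have "\<dots> \<le> (\<Sum>S\<in>Q. \<bar>(\<Prod>j\<in>{1..r}. a S j) - (\<Prod>j\<in>{1..r}. y S j)\<bar>)"
    by (rule order_trans[OF sum_abs]) (simp add: abs_mult power_abs)
  also have "\<dots> \<le> (\<Sum>S\<in>Q. real r * (real n / real (\<Prod>S)) ^ (r - 1))"
  proof (rule sum_mono)
    fix S assume "S \<in> Q"
    then have S: "S \<in> Pow P"
      using Q by auto
    have "\<bar>(\<Prod>j\<in>{1..r}. a S j) - (\<Prod>j\<in>{1..r}. y S j)\<bar>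
        \<le> real (card {1..r}) * (real n / real (\<Prod>S)) ^ (card {1..r} - 1)"
    proof (rule abs_prod_diff_le)
      show "0 < real n / real (\<Prod>S)"
        using assms prod_pos[OF S] by (intro divide_pos_pos) (simp_all only: of_nat_0_less_iff)
    qed (use assms S a_le a_ge y_le in \<open>auto simp: a_def\<close>)
    then show "\<bar>(\<Prod>j\<in>{1..r}. a S j) - (\<Prod>j\<in>{1..r}. y S j)\<bar>
        \<le> real r * (real n / real (\<Prod>S)) ^ (r - 1)"
      by simp
  qed
  also have "\<dots> = (\<Sum>d\<in>\<Prod> ` Q. real r * (real n / real d) ^ (r - 1))"
    using inj_on_prod_primes[OF P] Q by (subst sum.reindex) (auto intro: inj_on_subset)
  \<comment> \<open>The products of the sets in \<open>Q\<close> are integers between 1 and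
    \<open>n\<close>; the remaining \<open>d\<close> add only nonnegative terms.\<close>
  also have "\<dots> \<le> (\<Sum>d=1..n. real r * (real n / real d) ^ (r - 1))"
  proof (rule sum_mono2)
    have "\<Prod>S \<in> {1..n}" if "S \<in> Q" for S
      using that prod_pos[of S] by (auto simp: Q_def Suc_le_eq)
    then show "\<Prod> ` Q \<subseteq> {1..n}"
      by blast
  qed auto
  also have "\<dots> = real r * real n ^ (r - 1) * (\<Sum>d=1..n. 1 / real d ^ (r - 1))"
    by (simp add: power_divide sum_distrib_left)
  finally show "\<bar>real (F_count r n \<alpha>) - (\<Prod>j\<in>{1..r}. \<alpha> j) * K\<bar>
      \<le> real r * real n ^ (r - 1) * (\<Sum>d=1..n. 1 / real d ^ (r - 1))" .
qed

section \<open>Elementary sums\<close>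

lemma sum_inverse_squares_from_2: "(\<Sum>d=2..n. 1 / real d ^ 2) \<le> 3 / 4"
proof (cases "2 \<le> n")
  case True
  \<comment> \<open>The extra term \<open>- 1 / real n\<close> makes the induction telescope, and
    equality holds at \<open>n = 2\<close>.\<close>
  then have "(\<Sum>d=2..n. 1 / real d ^ 2) \<le> 3 / 4 - 1 / real n"
  proof (induction n rule: dec_induct)
    case (step n)
    have "1 / (real n + 1) ^ 2 \<le> 1 / (real n * (real n + 1))"
      using step by (intro divide_left_mono) (auto simp: power2_eq_square)
    also have "\<dots> = 1 / real n - 1 / (real n + 1)"
      using step by (simp add: field_simps)
    finally have "1 / (real n + 1) ^ 2 \<le> 1 / real n - 1 / (real n + 1)" .
    with step show ?case
      by (simp add: add.commute)
  qed simp
  moreover have "0 \<le> 1 / real n"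
    by simp
  ultimately show ?thesis
    by linarith
qed simp

text \<open>The difference \<open>harm n - ln n\<close> decreases from its value 1 at
  \<open>n = 1\<close>. The constant 1 is absorbed into \<open>2 * ln n\<close>, because
  \<open>ln 2\<close> is at least 2/3.\<close>

lemma harmonic_sum_le:
  assumes "2 \<le> n"
  shows "(\<Sum>d=1..n. 1 / real d) \<le> 3 * ln (real n)"
proof -
  have "harm n - ln (real n) \<le> harm 1 - ln (real 1)"
    using decseq_harm_diff_ln assms decseqD[OF decseq_harm_diff_ln, of 0 "n - 1"] by simp
  then have "(\<Sum>d=1..n. 1 / real d) \<le> 1 + ln (real n)"
    by (simp add: harm_def inverse_eq_divide)
  moreover have "ln 2 \<le> ln (real n)"
    using assms by simp
  ultimately show ?thesis
    using ln2_ge_two_thirds by simp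
qed

section \<open>The discrepancy\<close>

text \<open>A union bound instead of the sieve: a point whose gcd is not 1 lies in
  \<open>B d\<close> for some \<open>d\<close> from 2 to \<open>n\<close>. As
  \<open>r \<ge> 2\<close>, these sets together have at most \<open>n^r\<close> times 3/4 points,
  leaving a quarter of the full box.\<close>

lemma F_count_one_ge:
  assumes "1 \<le> n" "2 \<le> r"
  shows "real n ^ r / 4 \<le> real (F_count r n (\<lambda>j\<in>{1..r}. 1))"
proof -
  define \<alpha> :: "nat \<Rightarrow> real" where "\<alpha> = (\<lambda>j\<in>{1..r}. 1)"
  have \<alpha>: "\<alpha> \<in> unit_cube r"
    unfolding \<alpha>_def by (rule one_in_unit_cube)
  define B where "B d = {x \<in> lattice_box r n \<alpha>. \<forall>j\<in>{1..r}. d dvd x j}" for d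
  have card_B: "card (B d) = card (multiples_upto (real n) d) ^ r" for d
    unfolding B_def card_lattice_box_dvd by (simp add: \<alpha>_def)
  have "B 1 \<subseteq> {x \<in> lattice_box r n \<alpha>. Gcd (x ` {1..r}) = 1} \<union> (\<Union>d\<in>{2..n}. B d)"
  proof
    fix x assume "x \<in> B 1"
    then have x: "x \<in> lattice_box r n \<alpha>"
      by (simp add: B_def)
    have "0 < Gcd (x ` {1..r})" "Gcd (x ` {1..r}) \<le> n"
      using Gcd_lattice_box_bounds[OF x \<alpha>] assms by auto
    moreover have "x \<in> B (Gcd (x ` {1..r}))"
      using x by (auto simp: B_def intro!: Gcd_dvd)
    ultimately show "x \<in> {x \<in> lattice_box r n \<alpha>. Gcd (x ` {1..r}) = 1} \<union> (\<Union>d\<in>{2..n}. B d)"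
      using x by (cases "Gcd (x ` {1..r}) = 1") (auto intro!: bexI)
  qed
  then have "card (B 1) \<le> card ({x \<in> lattice_box r n \<alpha>. Gcd (x ` {1..r}) = 1} \<union> (\<Union>d\<in>{2..n}. B d))"
    by (intro card_mono) (auto simp: B_def)
  also have "\<dots> \<le> F_count r n \<alpha> + (\<Sum>d=2..n. card (B d))"
    unfolding F_count_eq by (rule order_trans[OF card_Un_le add_left_mono[OF card_UN_le]]) simp
  finally have "real (card (B 1)) \<le> real (F_count r n \<alpha>) + (\<Sum>d=2..n. real (card (B d)))"
    by (simp flip: of_nat_sum of_nat_add)
  moreover have "real (card (B 1)) = real n ^ r"
    by (simp add: card_B card_multiples_upto)
  moreover have "(\<Sum>d=2..n. real (card (B d))) \<le> (\<Sum>d=2..n. real n ^ r * (1 / real d ^ 2))"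
  proof (rule sum_mono)
    fix d assume d: "d \<in> {2..n}"
    have "real (card (B d)) \<le> (real n / real d) ^ r"
      unfolding card_B of_nat_power using d by (intro power_mono card_multiples_upto_le) auto
    also have "\<dots> \<le> real n ^ r * (1 / real d ^ 2)"
      using d assms by (auto simp: power_divide intro!: divide_left_mono power_increasing)
    finally show "real (card (B d)) \<le> real n ^ r * (1 / real d ^ 2)" .
  qed
  moreover have "(\<Sum>d=2..n. real n ^ r * (1 / real d ^ 2)) \<le> real n ^ r * (3 / 4)"
    unfolding sum_distrib_left[symmetric]
    by (intro mult_left_mono sum_inverse_squares_from_2) simp
  ultimately show ?thesis
    by (simp add: \<alpha>_def)
qed

definition local_discrepancy :: "nat \<Rightarrow> nat \<Rightarrow> (nat \<Rightarrow> real) \<Rightarrow> real" where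
  "local_discrepancy r n \<alpha> =
    \<bar>real (F_count r n \<alpha>) / real (F_count r n (\<lambda>j\<in>{1..r}. 1)) - (\<Prod>j\<in>{1..r}. \<alpha> j)\<bar>"

lemma discrepancy_eq_SUP: "discrepancy r n = (SUP \<alpha>\<in>unit_cube r. local_discrepancy r n \<alpha>)"
  unfolding discrepancy_def local_discrepancy_def ..

lemma local_discrepancy_le:
  assumes "1 \<le> n" "2 \<le> r" "\<alpha> \<in> unit_cube r"
  shows "local_discrepancy r n \<alpha>
    \<le> 8 * real r * (\<Sum>d=1..n. 1 / real d ^ (r - 1)) / real n"
proof -
  define H where "H = (\<Sum>d=1..n. 1 / real d ^ (r - 1))"
  define E where "E = real r * real n ^ (r - 1) * H"
  define N where "N = real (F_count r n (\<lambda>j\<in>{1..r}. 1))"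
  define A where "A = (\<Prod>j\<in>{1..r}. \<alpha> j)"
  have "1 \<le> r"
    using assms by simp
  then obtain K where K: "\<And>\<beta>. \<beta> \<in> unit_cube r \<Longrightarrow>
      \<bar>real (F_count r n \<beta>) - (\<Prod>j\<in>{1..r}. \<beta> j) * K\<bar> \<le> E"
    using F_count_approx[OF assms(1)] unfolding E_def H_def by blast
  have A: "0 \<le> A" "A \<le> 1"
    unfolding A_def using unit_cube_prod[OF assms(3)] .
  have N: "real n ^ r / 4 \<le> N"
    unfolding N_def by (rule F_count_one_ge[OF assms(1,2)])
  have pos: "0 < real n ^ r"
    using assms by simp
  with N have "0 < N"
    by linarith
  have "\<bar>N - K\<bar> \<le> E"
    using K[OF one_in_unit_cube] by (simp add: N_def)
  \<comment> \<open>Since \<open>A\<close> lies in [0,1], replacing \<open>K\<close> by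
    \<open>N\<close> in the main term costs at most another \<open>E\<close>.\<close>
  then have "A * \<bar>N - K\<bar> \<le> E"
    using A mult_left_le_one_le[of "\<bar>N - K\<bar>" A] by simp
  then have "\<bar>A * K - A * N\<bar> \<le> E"
    using A by (simp add: abs_mult abs_minus_commute flip: right_diff_distrib)
  with K[OF assms(3)] have *: "\<bar>real (F_count r n \<alpha>) - A * N\<bar> \<le> 2 * E"
    unfolding A_def[symmetric] by linarith
  have "real (F_count r n \<alpha>) / N - A = (real (F_count r n \<alpha>) - A * N) / N"
    using \<open>0 < N\<close> by (simp add: diff_divide_distrib)
  then have "\<bar>real (F_count r n \<alpha>) / N - A\<bar> = \<bar>real (F_count r n \<alpha>) - A * N\<bar> / N"
    using \<open>0 < N\<close> by (simp only: abs_divide abs_of_pos)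
  \<comment> \<open>The constant 8 is the doubled error times the 4 from the lower bound on
    \<open>N\<close>.\<close>
  also have "\<dots> \<le> 2 * E / (real n ^ r / 4)"
    using * N pos by (intro frac_le) auto
  also have "\<dots> = 8 * real r * H / real n"
    using assms by (cases r) (auto simp: E_def field_simps)
  finally show ?thesis
    unfolding local_discrepancy_def N_def A_def H_def .
qed

lemma discrepancy_le:
  assumes "1 \<le> n" "2 \<le> r"
  shows "discrepancy r n \<le> 8 * real r * (\<Sum>d=1..n. 1 / real d ^ (r - 1)) / real n"
  unfolding discrepancy_eq_SUP
proof (rule cSUP_least)
  show "unit_cube r \<noteq> {}"
    using one_in_unit_cube by blast
qed (rule local_discrepancy_le[OF assms])

lemma discrepancy_ge:
  assumes "1 \<le> n" "2 \<le> r"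
  shows "1 / 2 / real n \<le> discrepancy r n"
proof -
  \<comment> \<open>The first side of the box has length 1/2, so it contains no positive integer,
    while the volume is still \<open>1 / (2 * real n)\<close>.\<close>
  define \<alpha> :: "nat \<Rightarrow> real" where "\<alpha> = (\<lambda>j\<in>{1..r}. if j = 1 then 1 / (2 * real n) else 1)"
  have \<alpha>: "\<alpha> \<in> unit_cube r"
    using assms by (auto simp: \<alpha>_def unit_cube_def)
  have "F_count r n \<alpha> = 0"
  proof -
    have "real n * \<alpha> 1 = 1 / 2"
      using assms by (simp add: \<alpha>_def)
    then have "multiples_upto (real n * \<alpha> 1) 1 = {}"
      by (auto simp: multiples_upto_def)
    then have "lattice_box r n \<alpha> = {}"
      unfolding lattice_box_def PiE_eq_empty_iff using assms by (intro bexI[of _ 1]) auto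
    then show ?thesis
      by (simp add: F_count_eq)
  qed
  moreover have "(\<Prod>j\<in>{1..r}. \<alpha> j) = 1 / (2 * real n)"
    using assms by (simp add: \<alpha>_def prod.delta)
  ultimately have "1 / 2 / real n = local_discrepancy r n \<alpha>"
    by (simp add: local_discrepancy_def)
  also have "\<dots> \<le> discrepancy r n"
    unfolding discrepancy_eq_SUP
    \<comment> \<open>The upper bound is uniform in \<alpha>, so it also supplies the boundedness
      without which the supremum would be unspecified.\<close>
    by (rule cSUP_upper[OF \<alpha>], rule bdd_aboveI2, rule local_discrepancy_le[OF assms])
  finally show ?thesis .
qed

theorem theorem4p1:
  shows "(\<exists>c C :: real. 0 < c \<and> c < C \<and>
            (\<forall>n::nat. 2 \<le> n \<longrightarrow>
               c / real n \<le> discrepancy 2 n \<and>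
               discrepancy 2 n \<le> C * (ln (real n) / real n)))
       \<and> (\<forall>r::nat. 3 \<le> r \<longrightarrow>
            (\<exists>c C :: real. 0 < c \<and> c < C \<and>
               (\<forall>n::nat. 1 \<le> n \<longrightarrow>
                  c / real n \<le> discrepancy r n \<and>
                  discrepancy r n \<le> C / real n)))"
proof (intro conjI allI impI)
  have "discrepancy 2 n \<le> 48 * (ln (real n) / real n)" if "2 \<le> n" for n
  proof -
    \<comment> \<open>With \<open>r = 2\<close> the exponent \<open>r - 1\<close> is 1, so the error
      sum is harmonic and produces the logarithm; 48 is 8 * 2 * 3.\<close>
    have "discrepancy 2 n \<le> 16 * (\<Sum>d=1..n. 1 / real d) / real n"
      using discrepancy_le[of n 2] that by simp
    also have "\<dots> \<le> 16 * (3 * ln (real n)) / real n"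
      by (intro divide_right_mono mult_left_mono harmonic_sum_le that) auto
    finally show ?thesis
      by simp
  qed
  then show "\<exists>c C :: real. 0 < c \<and> c < C \<and>
      (\<forall>n::nat. 2 \<le> n \<longrightarrow> c / real n \<le> discrepancy 2 n \<and>
        discrepancy 2 n \<le> C * (ln (real n) / real n))"
    using discrepancy_ge[of _ 2] by (intro exI[of _ "1 / 2"] exI[of _ 48]) auto
next
  fix r :: nat assume r: "3 \<le> r"
  have "discrepancy r n \<le> 16 * real r / real n" if n: "1 \<le> n" for n
  proof -
    \<comment> \<open>From \<open>r = 3\<close> on the exponent is at least 2, so the error sum is
      bounded independently of \<open>n\<close>.\<close>
    have "(\<Sum>d=1..n. 1 / real d ^ (r - 1)) \<le> (\<Sum>d=1..n. 1 / real d ^ 2)"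
      using r by (intro sum_mono divide_left_mono power_increasing) auto
    also have "\<dots> = 1 + (\<Sum>d=2..n. 1 / real d ^ 2)"
      using n by (simp add: sum.atLeast_Suc_atMost numeral_2_eq_2)
    also have "\<dots> \<le> 2"
      using sum_inverse_squares_from_2[of n] by simp
    finally have H: "(\<Sum>d=1..n. 1 / real d ^ (r - 1)) \<le> 2" .
    have "discrepancy r n \<le> 8 * real r * (\<Sum>d=1..n. 1 / real d ^ (r - 1)) / real n"
      using discrepancy_le[of n r] n r by simp
    also have "\<dots> \<le> 8 * real r * 2 / real n"
      by (intro divide_right_mono mult_left_mono H) auto
    finally show ?thesis
      by simp
  qed
  then show "\<exists>c C :: real. 0 < c \<and> c < C \<and>
      (\<forall>n::nat. 1 \<le> n \<longrightarrow> c / real n \<le> discrepancy r n \<and> discrepancy r n \<le> C / real n)"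
    using discrepancy_ge[of _ r] r by (intro exI[of _ "1 / 2"] exI[of _ "16 * real r"]) auto
qed

end
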